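(* Let $(\alpha,\beta)\in\mathbb{R}^n\times\mathbb{R}$. Then the inequality $$y+\sum_{j\in[n]}\alpha_j z_j\geq\beta$$ is a valid inequality for $\mathrm{conv}(\mathcal{Q})$ if and only if $(\alpha,\beta)\in\mathcal{G}$.
   Context: Let $n\ge 1$ be an integer and $[n]=\{1,\dots,n\}$. Let $h_1\geq h_2\geq\cdots\geq h_n\geq 0$ be reals, let $a\in\mathbb{R}^n$ with $a_j\ge 0$ for all $j$, and let $p\ge 0$ be real, with $a_j\leq p$ for all $j\in[n]$ and $\sum_{j\in[n]}a_j>p$. Define $$\mathcal{Q}:=\Big\{(y,z)\in\mathbb{R}_+\times\{0,1\}^n:\ \sum_{j\in[n]}a_jz_j\leq p,\ \ y+h_jz_j\geq h_j\ \ \forall j\in[n]\Big\},$$ where $\mathbb{R}_+$ denotes the nonnegative reals. Let $\nu:=\max\{k\in\{0,\dots,n\}:\sum_{j\leq k}a_j\leq p\}$ (so $\nu<n$). For $0\leq k\leq\nu$ let $$\mathcal{P}_k:=\Big\{z\in\{0,1\}^n:\ \sum_{j>k}a_jz_j\leq p-\sum_{j\leq k}a_j\Big\}.$$ The coefficient polyhedron $\mathcal{G}$ is the set of all $(\alpha,\beta)\in\mathbb{R}^n\times\mathbb{R}$ such that $$\sum_{j\leq k}\alpha_j+\sum_{j>k}\alpha_jz^*_j+h_{k+1}\geq\beta\qquad\forall\, z^*\in\mathcal{P}_k,\ \forall\, 0\leq k\leq\nu.$$ *)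

theory Defs
  imports "HOL-Analysis.Analysis"
begin

text \<open>
  The index set \<open>[n]\<close> is an arbitrary finite linearly ordered type \<open>'n\<close>, with
  \<open>n = CARD('n)\<close>, so that the mixing set lives in the real vector space
  \<open>real \<times> (real ^ 'n)\<close>. Prefixes and suffixes of \<open>[n]\<close> are addressed by position
  through \<open>idx\<close>, which sends \<open>j \<in> {1..n}\<close> to the \<open>j\<close>-th smallest index; its values outside
  \<open>{1..n}\<close> carry no meaning and are never used.
\<close>

definition idx :: "nat \<Rightarrow> 'n::{finite,linorder}" where
  "idx j = sorted_list_of_set UNIV ! (j - 1)"

lemma bij_betw_idx: "bij_betw (idx :: nat \<Rightarrow> 'n::{finite,linorder}) {1..CARD('n)} UNIV"
proof -
  let ?xs = "sorted_list_of_set (UNIV :: 'n set)"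
  have "bij_betw (\<lambda>j. j - 1) {1..CARD('n)} {..<CARD('n)}"
    by (rule bij_betw_byWitness[where f' = Suc]) auto
  moreover have "bij_betw ((!) ?xs) {..<CARD('n)} UNIV"
    by (rule bij_betw_nth) simp_all
  ultimately have "bij_betw ((!) ?xs \<circ> (\<lambda>j. j - 1)) {1..CARD('n)} UNIV"
    by (rule bij_betw_trans)
  then show ?thesis
    by (simp add: idx_def[abs_def] comp_def)
qed

lemma strict_mono_on_idx: "strict_mono_on {1..CARD('n)} (idx :: nat \<Rightarrow> 'n::{finite,linorder})"
proof (rule strict_mono_onI)
  fix i j :: nat
  assume "i \<in> {1..CARD('n)}" "j \<in> {1..CARD('n)}" "i < j"
  then show "idx i < (idx j :: 'n)"
    unfolding idx_def
    by (intro sorted_wrt_nth_less[OF strict_sorted_list_of_set]) auto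
qed

definition mixing_set ::
    "real ^ 'n::{finite,linorder} \<Rightarrow> real ^ 'n::{finite,linorder} \<Rightarrow> real \<Rightarrow>
      (real \<times> (real ^ 'n::{finite,linorder})) set" where
  "mixing_set h a p = {(y, z). 0 \<le> y \<and> (\<forall>j. z $ j \<in> {0, 1}) \<and>
     (\<Sum>j\<in>UNIV. a $ j * z $ j) \<le> p \<and> (\<forall>j. y + h $ j * z $ j \<ge> h $ j)}"

definition nu :: "real ^ 'n::{finite,linorder} \<Rightarrow> real \<Rightarrow> nat" where
  "nu a p = Max {k \<in> {0..CARD('n)}. (\<Sum>j=1..k. a $ idx j) \<le> p}"

definition prefix_knapsack ::
    "real ^ 'n::{finite,linorder} \<Rightarrow> real \<Rightarrow> nat \<Rightarrow> (real ^ 'n::{finite,linorder}) set" where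
  "prefix_knapsack a p k = {z. (\<forall>j. z $ j \<in> {0, 1}) \<and>
     (\<Sum>j=k+1..CARD('n). a $ idx j * z $ idx j) \<le> p - (\<Sum>j=1..k. a $ idx j)}"

definition coefficient_polyhedron ::
    "real ^ 'n::{finite,linorder} \<Rightarrow> real ^ 'n::{finite,linorder} \<Rightarrow> real \<Rightarrow>
      ((real ^ 'n::{finite,linorder}) \<times> real) set" where
  "coefficient_polyhedron h a p = {(\<alpha>, \<beta>). \<forall>k\<in>{0..nu a p}. \<forall>z\<in>prefix_knapsack a p k.
     (\<Sum>j=1..k. \<alpha> $ idx j) + (\<Sum>j=k+1..CARD('n). \<alpha> $ idx j * z $ idx j)
       + h $ idx (k + 1) \<ge> \<beta>}"

end

theory Submission
  imports Defs
begin

text \<open>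
  A linear inequality is valid for a convex hull iff it is valid for the generating set, so only
  points of the mixing set itself matter. The two directions then rest on a correspondence between
  these points and the pairs \<open>(k, z)\<close> with \<open>k \<le> \<nu>\<close> and \<open>z \<in> \<P>\<^sub>k\<close>.

  Given such a pair, overwrite the first \<open>k\<close> coordinates of \<open>z\<close> by \<open>1\<close> and put \<open>y = h\<^sub>k\<^sub>+\<^sub>1\<close>. Because
  \<open>h\<close> is nonincreasing and nonnegative, this is a point of the mixing set, and validity at it is
  exactly the inequality of the coefficient polyhedron that belongs to \<open>(k, z)\<close>
  (\<open>fill_prefix_in_mixing_set\<close>).

  Conversely, for \<open>(y, z)\<close> in the mixing set let \<open>k + 1\<close> be the first position at which \<open>z\<close> vanishes.
  It exists because \<open>z\<close> satisfies the knapsack constraint and the total weight exceeds \<open>p\<close>. The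
  mixing constraint at \<open>k + 1\<close> says \<open>y \<ge> h\<^sub>k\<^sub>+\<^sub>1\<close>, and the inequality for \<open>(k, z)\<close> gives the claim
  (\<open>mixing_set_first_zero\<close>).
\<close>

lemma sum_UNIV_split_idx:
  fixes f :: "'n::{finite,linorder} \<Rightarrow> 'b::comm_monoid_add"
  assumes "k \<le> CARD('n)"
  shows "sum f UNIV = (\<Sum>j=1..k. f (idx j)) + (\<Sum>j=k+1..CARD('n). f (idx j))"
proof -
  have "sum f UNIV = (\<Sum>j=1..CARD('n). f (idx j))"
    by (rule sum.reindex_bij_betw[OF bij_betw_idx, symmetric])
  also have "\<dots> = (\<Sum>j=1..k. f (idx j)) + (\<Sum>j=k+1..CARD('n). f (idx j))"
    using sum.ub_add_nat[of 1 k "\<lambda>j. f (idx j)" "CARD('n) - k"] assms by simp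
  finally show ?thesis .
qed

lemma idx_surj:
  obtains m where "m \<in> {1..CARD('n)}" "(i :: 'n::{finite,linorder}) = idx m"
  using bij_betw_imp_surj_on[OF bij_betw_idx[where 'n = 'n]] by blast

lemma idx_mono:
  assumes "1 \<le> i" "i \<le> j" "j \<le> CARD('n)"
  shows "idx i \<le> (idx j :: 'n::{finite,linorder})"
  using strict_mono_onD[OF strict_mono_on_idx[where 'n = 'n], of i j] assms
  by (cases "i = j") (auto intro: less_imp_le)

lemma le_nu_iff:
  fixes a :: "real ^ 'n::{finite,linorder}"
  assumes "\<And>j. a $ j \<ge> 0" and "p \<ge> 0" and "k \<le> CARD('n)"
  shows "k \<le> nu a p \<longleftrightarrow> (\<Sum>j=1..k. a $ idx j) \<le> p"
proof -
  let ?K = "{k \<in> {0..CARD('n)}. (\<Sum>j=1..k. a $ idx j) \<le> p}"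
  have fin: "finite ?K"
    by simp
  have "0 \<in> ?K"
    using assms(2) by simp
  then have "nu a p \<in> ?K"
    unfolding nu_def using Max_in[OF fin] by blast
  then have sum_nu: "(\<Sum>j=1..nu a p. a $ idx j) \<le> p"
    by simp
  show ?thesis
  proof
    assume "k \<le> nu a p"
    then have "(\<Sum>j=1..k. a $ idx j) \<le> (\<Sum>j=1..nu a p. a $ idx j)"
      using assms(1) by (intro sum_mono2) auto
    with sum_nu show "(\<Sum>j=1..k. a $ idx j) \<le> p"
      by simp
  next
    assume "(\<Sum>j=1..k. a $ idx j) \<le> p"
    then show "k \<le> nu a p"
      unfolding nu_def using assms(3) by (intro Max_ge[OF fin]) simp
  qed
qed

lemma nu_less_card:
  fixes a :: "real ^ 'n::{finite,linorder}"
  assumes "\<And>j. a $ j \<ge> 0" and "p \<ge> 0" and "(\<Sum>j\<in>UNIV. a $ j) > p"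
  shows "nu a p < CARD('n)"
proof (rule ccontr)
  assume "\<not> nu a p < CARD('n)"
  then have "(\<Sum>j=1..CARD('n). a $ idx j) \<le> p"
    using le_nu_iff[OF assms(1,2), of "CARD('n)"] by simp
  with assms(3) show False
    using sum_UNIV_split_idx[of "CARD('n)" "\<lambda>j. a $ j"] by simp
qed

text \<open>The vector that agrees with \<open>z\<close> beyond position \<open>k\<close> and is \<open>1\<close> at the first \<open>k\<close> positions.\<close>

definition fill_prefix :: "nat \<Rightarrow> real ^ 'n::{finite,linorder} \<Rightarrow> real ^ 'n::{finite,linorder}" where
  "fill_prefix k z = (\<chi> i. if i \<in> idx ` {1..k} then 1 else z $ i)"

lemma fill_prefix_idx:
  assumes "j \<in> {1..CARD('n)}" "k \<le> CARD('n)"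
  shows "fill_prefix k z $ (idx j :: 'n::{finite,linorder}) = (if j \<le> k then 1 else z $ idx j)"
proof -
  have "(idx j :: 'n) \<in> idx ` {1..k} \<longleftrightarrow> j \<in> {1..k}"
    using bij_betw_imp_inj_on[OF bij_betw_idx[where 'n = 'n]] assms
    by (intro inj_on_image_mem_iff) auto
  then show ?thesis
    using assms by (simp add: fill_prefix_def)
qed

lemma sum_fill_prefix:
  fixes c z :: "real ^ 'n::{finite,linorder}"
  assumes "k \<le> CARD('n)"
  shows "(\<Sum>i\<in>UNIV. c $ i * fill_prefix k z $ i) =
    (\<Sum>j=1..k. c $ idx j) + (\<Sum>j=k+1..CARD('n). c $ idx j * z $ idx j)"
proof -
  have "(\<Sum>j=1..k. c $ idx j * fill_prefix k z $ idx j) = (\<Sum>j=1..k. c $ idx j)"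
    using assms by (intro sum.cong) (auto simp: fill_prefix_idx)
  moreover have "(\<Sum>j=k+1..CARD('n). c $ idx j * fill_prefix k z $ idx j) =
      (\<Sum>j=k+1..CARD('n). c $ idx j * z $ idx j)"
    using assms by (intro sum.cong) (auto simp: fill_prefix_idx)
  ultimately show ?thesis
    using sum_UNIV_split_idx[OF assms, of "\<lambda>i. c $ i * fill_prefix k z $ i"] by simp
qed

lemma fill_prefix_in_mixing_set:
  fixes h a z :: "real ^ 'n::{finite,linorder}"
  assumes h_antimono: "\<And>i j. i \<le> j \<Longrightarrow> h $ i \<ge> h $ j"
    and h_nonneg: "\<And>j. h $ j \<ge> 0"
    and k: "k < CARD('n)"
    and z: "z \<in> prefix_knapsack a p k"
  shows "(h $ idx (k + 1), fill_prefix k z) \<in> mixing_set h a p"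
proof -
  have bin: "z $ i \<in> {0, 1}" for i
    using z by (auto simp: prefix_knapsack_def)
  have "fill_prefix k z $ i \<in> {0, 1}" for i
    using bin[of i] by (simp add: fill_prefix_def)
  moreover have "(\<Sum>i\<in>UNIV. a $ i * fill_prefix k z $ i) \<le> p"
    using z k by (simp add: sum_fill_prefix prefix_knapsack_def)
  moreover have "h $ idx (k + 1) + h $ i * fill_prefix k z $ i \<ge> h $ i" for i
  proof -
    obtain m where m: "m \<in> {1..CARD('n)}" "i = idx m"
      by (rule idx_surj)
    show ?thesis
    proof (cases "m \<le> k")
      case True
      then show ?thesis
        using m k h_nonneg by (simp add: fill_prefix_idx)
    next
      case False
      then have "idx (k + 1) \<le> i"
        using m k by (auto intro: idx_mono)
      then have "h $ idx (k + 1) \<ge> h $ i"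
        by (rule h_antimono)
      moreover have "h $ i * fill_prefix k z $ i \<ge> 0"
        using h_nonneg[of i] bin[of i] by (auto simp: fill_prefix_def)
      ultimately show ?thesis
        by linarith
    qed
  qed
  ultimately show ?thesis
    using h_nonneg by (simp add: mixing_set_def)
qed

text \<open>
  The number \<open>k\<close> below is the length of the longest prefix on which \<open>z\<close> is constantly \<open>1\<close>; position
  \<open>k + 1\<close> is therefore the first zero of \<open>z\<close>.
\<close>

lemma mixing_set_first_zero:
  fixes h a z :: "real ^ 'n::{finite,linorder}"
  assumes a_nonneg: "\<And>j. a $ j \<ge> 0"
    and p_nonneg: "p \<ge> 0"
    and sum_a: "(\<Sum>j\<in>UNIV. a $ j) > p"
    and yz: "(y, z) \<in> mixing_set h a p"
  obtains k where "k \<le> nu a p" "k < CARD('n)" "z \<in> prefix_knapsack a p k"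
    "y \<ge> h $ idx (k + 1)" "\<And>j. j \<in> {1..k} \<Longrightarrow> z $ idx j = 1"
proof -
  have bin: "z $ i \<in> {0, 1}" for i
    using yz by (simp add: mixing_set_def)
  have knap: "(\<Sum>i\<in>UNIV. a $ i * z $ i) \<le> p"
    using yz by (simp add: mixing_set_def)
  have mix: "y + h $ i * z $ i \<ge> h $ i" for i
    using yz by (simp add: mixing_set_def)
  define zero where "zero k \<longleftrightarrow> k < CARD('n) \<and> z $ (idx (k + 1) :: 'n) = 0" for k
  have "\<exists>i. z $ i \<noteq> 1"
  proof (rule ccontr)
    assume "\<not> (\<exists>i. z $ i \<noteq> 1)"
    then show False
      using knap sum_a by simp
  qed
  then obtain i where "z $ i = 0"
    using bin by blast
  moreover obtain m where "m \<in> {1..CARD('n)}" "i = idx m"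
    by (rule idx_surj)
  ultimately have "zero (m - 1)"
    by (auto simp: zero_def)
  define k where "k = (LEAST k. zero k)"
  have "zero k"
    unfolding k_def by (rule LeastI) fact
  then have k: "k < CARD('n)" "z $ (idx (k + 1) :: 'n) = 0"
    by (auto simp: zero_def)
  have ones: "z $ (idx j :: 'n) = 1" if "j \<in> {1..k}" for j
  proof -
    have "j - 1 < k"
      using that by auto
    then have "\<not> zero (j - 1)"
      unfolding k_def by (rule not_less_Least)
    then show ?thesis
      using that k(1) bin[of "idx j"] by (auto simp: zero_def)
  qed
  have split: "(\<Sum>j=1..k. a $ idx j) + (\<Sum>j=k+1..CARD('n). a $ idx j * z $ idx j) \<le> p"
    using knap sum_UNIV_split_idx[of k "\<lambda>i. a $ i * z $ i"] k(1) ones by simp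
  have "(\<Sum>j=k+1..CARD('n). a $ idx j * z $ idx j) \<ge> 0"
  proof (rule sum_nonneg)
    fix j
    show "0 \<le> a $ idx j * z $ (idx j :: 'n)"
      using a_nonneg bin[of "idx j"] by auto
  qed
  with split have "(\<Sum>j=1..k. a $ idx j) \<le> p"
    by linarith
  then have "k \<le> nu a p"
    using le_nu_iff[OF a_nonneg p_nonneg] k(1) by simp
  moreover have "z \<in> prefix_knapsack a p k"
    using split bin by (simp add: prefix_knapsack_def)
  moreover have "y \<ge> h $ idx (k + 1)"
    using mix[of "idx (k + 1)"] k(2) by simp
  ultimately show ?thesis
    using that k(1) ones by blast
qed

lemma valid_convex_hull_iff:
  fixes \<alpha> :: "real ^ 'n::finite" and S :: "(real \<times> (real ^ 'n)) set"
  shows "(\<forall>(y, z) \<in> convex hull S. y + (\<Sum>j\<in>UNIV. \<alpha> $ j * z $ j) \<ge> \<beta>) \<longleftrightarrow>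
    (\<forall>(y, z) \<in> S. y + (\<Sum>j\<in>UNIV. \<alpha> $ j * z $ j) \<ge> \<beta>)"
proof -
  \<comment> \<open>The left-hand side of the inequality is the inner product of \<open>(y, z)\<close> with \<open>(1, \<alpha>)\<close>.\<close>
  let ?H = "{x. (1, \<alpha>) \<bullet> x \<ge> \<beta>}"
  have "convex ?H"
    by (rule convex_halfspace_ge)
  then have "convex hull S \<subseteq> ?H \<longleftrightarrow> S \<subseteq> ?H"
    by (metis hull_minimal hull_subset subset_trans)
  then show ?thesis
    by (auto simp: inner_vec_def inner_prod_def subset_iff)
qed

theorem theorem1:
  fixes h a \<alpha> :: "real ^ 'n::{finite,linorder}" and p \<beta> :: real
  assumes h_antimono: "\<And>i j. i \<le> j \<Longrightarrow> h $ i \<ge> h $ j"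
    and h_nonneg: "\<And>j. h $ j \<ge> 0"
    and a_nonneg: "\<And>j. a $ j \<ge> 0"
    and p_nonneg: "p \<ge> 0"
    and a_le_p: "\<And>j. a $ j \<le> p"
    and sum_a: "(\<Sum>j\<in>UNIV. a $ j) > p"
  shows "(\<forall>(y, z) \<in> convex hull (mixing_set h a p). y + (\<Sum>j\<in>UNIV. \<alpha> $ j * z $ j) \<ge> \<beta>)
    \<longleftrightarrow> (\<alpha>, \<beta>) \<in> coefficient_polyhedron h a p"
  unfolding valid_convex_hull_iff
proof
  assume valid: "\<forall>(y, z) \<in> mixing_set h a p. y + (\<Sum>j\<in>UNIV. \<alpha> $ j * z $ j) \<ge> \<beta>"
  have "(\<Sum>j=1..k. \<alpha> $ idx j) + (\<Sum>j=k+1..CARD('n). \<alpha> $ idx j * z $ idx j)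
      + h $ idx (k + 1) \<ge> \<beta>"
    if "k \<le> nu a p" and z: "z \<in> prefix_knapsack a p k" for k z
  proof -
    have k: "k < CARD('n)"
      using that(1) nu_less_card[OF a_nonneg p_nonneg sum_a] by simp
    have "h $ idx (k + 1) + (\<Sum>j\<in>UNIV. \<alpha> $ j * fill_prefix k z $ j) \<ge> \<beta>"
      using valid fill_prefix_in_mixing_set[OF h_antimono h_nonneg k z] by blast
    then show ?thesis
      using k by (simp add: sum_fill_prefix algebra_simps)
  qed
  then show "(\<alpha>, \<beta>) \<in> coefficient_polyhedron h a p"
    by (simp add: coefficient_polyhedron_def)
next
  assume coeff: "(\<alpha>, \<beta>) \<in> coefficient_polyhedron h a p"
  have "y + (\<Sum>j\<in>UNIV. \<alpha> $ j * z $ j) \<ge> \<beta>" if yz: "(y, z) \<in> mixing_set h a p" for y z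
  proof -
    obtain k where k: "k \<le> nu a p" "k < CARD('n)" "z \<in> prefix_knapsack a p k"
      "y \<ge> h $ idx (k + 1)" and ones: "\<And>j. j \<in> {1..k} \<Longrightarrow> z $ idx j = 1"
      using mixing_set_first_zero[OF a_nonneg p_nonneg sum_a yz] by blast
    have "(\<Sum>j\<in>UNIV. \<alpha> $ j * z $ j) =
        (\<Sum>j=1..k. \<alpha> $ idx j) + (\<Sum>j=k+1..CARD('n). \<alpha> $ idx j * z $ idx j)"
      using sum_UNIV_split_idx[of k "\<lambda>i. \<alpha> $ i * z $ i"] k(2) ones by simp
    moreover have "(\<Sum>j=1..k. \<alpha> $ idx j) + (\<Sum>j=k+1..CARD('n). \<alpha> $ idx j * z $ idx j)
        + h $ idx (k + 1) \<ge> \<beta>"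
      using coeff k(1,3) by (simp add: coefficient_polyhedron_def)
    ultimately show ?thesis
      using k(4) by linarith
  qed
  then show "\<forall>(y, z) \<in> mixing_set h a p. y + (\<Sum>j\<in>UNIV. \<alpha> $ j * z $ j) \<ge> \<beta>"
    by blast
qed

end
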